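(* Let $d \in \mathbb{N}$ and let $\mathcal{K}$ be a finite set of positive integers. For $r \ge 0$ let $S_d(r) = \{\mathbf{s} = (s_1, \ldots, s_d) \in \mathbb{Z}_{\ge 0}^d : s_1 + \cdots + s_d = r\}$. Suppose $\alpha_0 \in \mathcal{R}$ and $\alpha_{\mathbf{s}} \in \mathcal{R}$ for $\mathbf{s} \in S_d(r)$, $r \in \mathcal{K} \cup \{0\}$, and let \[ P(u_1, \ldots, u_d) = \alpha_0 + \sum_{r \in \mathcal{K} \cup \{0\}} \sum_{\mathbf{s} \in S_d(r)} \alpha_{\mathbf{s}} \prod_{j=1}^d u_j^{s_j} \in \mathcal{R}[u_1, \ldots, u_d]. \] Suppose that for some $k \in \mathcal{K}$ and some $\mathbf{l} \in S_d(k)$: (i) $p \nmid k$; (ii) for every positive integer $v$, $p^v k \notin \mathcal{K}$; (iii) $\alpha_{\mathbf{l}} \notin \mathcal{Q}$. Then the sequence $(P(\mathbf{u}) \bmod \mathcal{Z})_{\mathbf{u} \in \mathcal{Z}^d}$ is well-distributed in $\mathcal{T}$.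
   Context: Fix a finite field $\mathbb{F}_q$ of characteristic $p$. Let $\mathcal{Z} = \mathbb{F}_q[t]$, $\mathcal{Q} = \mathbb{F}_q(t)$, $\mathcal{R} = \mathbb{F}_q((t^{-1}))$ (formal Laurent series in $t^{-1}$, the completion of $\mathcal{Q}$ for $|u/v| = q^{\deg u - \deg v}$), and $\mathcal{T} = \mathcal{R}/\mathcal{Z}$; each element of $\mathcal{T}$ has a unique representative $\sum_{n=-\infty}^{-1} c_n t^n$. For $M \in \mathbb{N}$ and $a_1, \ldots, a_M \in \mathbb{F}_q$, the cylinder set $C(M; a_1, \ldots, a_M) \subseteq \mathcal{T}$ consists of the elements whose representative has $c_{-1} = a_1, \ldots, c_{-M} = a_M$. A Følner sequence in $\mathcal{Z}^d$ is a sequence $(F_N)$ of finite nonempty subsets of $\mathcal{Z}^d$ with $|F_N \cap (F_N + \mathbf{u})|/|F_N| \to 1$ for every $\mathbf{u} \in \mathcal{Z}^d$. A sequence $(a(\mathbf{u}))_{\mathbf{u} \in \mathcal{Z}^d}$ in $\mathcal{T}$ is well-distributed if for every Følner sequence $(F_N)$ in $\mathcal{Z}^d$, every $M \in \mathbb{N}$ and all $a_1, \ldots, a_M \in \mathbb{F}_q$, $|\{\mathbf{u} \in F_N : a(\mathbf{u}) \in C(M; a_1, \ldots, a_M)\}|/|F_N| \to q^{-M}$. *)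

theory Defs
  imports Complex_Main "HOL-Computational_Algebra.Formal_Laurent_Series"
begin

text \<open>Conventions. The base field F_q is a finite field type 'a (q = CARD('a),
 p = CHAR('a)). The ring Z = F_q[t] is the type 'a poly.
 The field R = F_q((t^-1)) is modelled by the type 'a fls of formal Laurent series
 in a variable X (finitely many negative powers), where X stands for t^-1.
 Thus fls_nth f n is the coefficient of t^(-n), and t itself is fls_X_inv.\<close>

definition Z_to_R :: "'a::field poly \<Rightarrow> 'a fls" where
  "Z_to_R u = (\<Sum>n\<le>degree u. fls_const (coeff u n) * fls_X_inv ^ n)"

definition in_Q :: "'a::field fls \<Rightarrow> bool" where
  "in_Q \<alpha> \<longleftrightarrow> (\<exists>u v. v \<noteq> 0 \<and> \<alpha> * Z_to_R v = Z_to_R u)"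

text \<open>Cylinder set C(M; a_1..a_M) in T = R/Z: the representative with only negative
 powers of t has c_(-i) = a_i for 1 \<le> i \<le> M; the coefficient of t^(-i), i \<ge> 1,
 does not depend on the representative modulo Z.\<close>
definition in_cylinder :: "nat \<Rightarrow> (nat \<Rightarrow> 'a::zero) \<Rightarrow> 'a fls \<Rightarrow> bool" where
  "in_cylinder M a x \<longleftrightarrow> (\<forall>i\<in>{1..M}. fls_nth x (int i) = a i)"

definition Zd :: "nat \<Rightarrow> (nat \<Rightarrow> 'a::zero poly) set" where
  "Zd d = {u. \<forall>j\<ge>d. u j = 0}"

definition folner :: "nat \<Rightarrow> (nat \<Rightarrow> (nat \<Rightarrow> 'a::comm_ring poly) set) \<Rightarrow> bool" where
  "folner d F \<longleftrightarrow> (\<forall>N. F N \<subseteq> Zd d \<and> finite (F N) \<and> F N \<noteq> {}) \<and>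
     (\<forall>v\<in>Zd d. (\<lambda>N. real (card (F N \<inter> (\<lambda>x j. x j + v j) ` F N)) / real (card (F N)))
        \<longlonglongrightarrow> 1)"

definition well_distributed :: "nat \<Rightarrow> ((nat \<Rightarrow> 'a::{field,finite} poly) \<Rightarrow> 'a fls) \<Rightarrow> bool" where
  "well_distributed d a \<longleftrightarrow> (\<forall>F. folner d F \<longrightarrow> (\<forall>M (c :: nat \<Rightarrow> 'a).
     (\<lambda>N. real (card {u \<in> F N. in_cylinder M c (a u)}) / real (card (F N)))
       \<longlonglongrightarrow> 1 / real (card (UNIV :: 'a set)) ^ M))"

definition Sd :: "nat \<Rightarrow> nat \<Rightarrow> (nat \<Rightarrow> nat) set" where
  "Sd d r = {s. (\<forall>j\<ge>d. s j = 0) \<and> (\<Sum>j<d. s j) = r}"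

definition polyP :: "nat \<Rightarrow> nat set \<Rightarrow> 'a::field fls \<Rightarrow> ((nat \<Rightarrow> nat) \<Rightarrow> 'a fls)
     \<Rightarrow> (nat \<Rightarrow> 'a poly) \<Rightarrow> 'a fls" where
  "polyP d K \<alpha>0 \<alpha> u = \<alpha>0 + (\<Sum>r\<in>K \<union> {0}. \<Sum>s\<in>Sd d r. \<alpha> s * (\<Prod>j<d. Z_to_R (u j) ^ s j))"

end

theory Submission
  imports Defs "HOL-Library.FuncSet" "HOL-Number_Theory.Cong" "HOL-Analysis.Convex"
begin

text \<open>
  By orthogonality of additive characters it suffices that, for every nonzero combination of
  the digits of \<open>P(u)\<close>, a nontrivial character of it averages to \<open>0\<close> along Folner
  sequences. Such a character has the form \<open>u \<mapsto> \<Prod>\<^sub>s \<eta>\<^sub>s(u\<^sup>s)\<close> with characters \<open>\<eta>\<^sub>s\<close> of the additive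
  group \<open>F_q[t]\<close>. As \<open>x \<mapsto> x\<^sup>p\<close> is additive, \<open>\<eta>(x\<^sup>p)\<close> is again a character in \<open>x\<close>, so one may assume that no
  exponent vector is divisible by \<open>p\<close>; the hypotheses on \<open>k\<close> ensure that \<open>\<eta>\<^sub>l\<close>
  survives this reduction unchanged. Irrationality of \<open>\<alpha>\<^sub>l\<close> becomes the
  statement that \<open>\<eta>\<^sub>l\<close> is not a torsion element of the \<open>F_q[t]\<close>-module of characters.

  The average is bounded by van der Corput differencing in one coordinate direction. The point is to
  use only shifts of the form \<open>y\<close> to the power \<open>p\<^sup>V\<close> with \<open>V\<close> large: after reducing the differenced
  polynomial, its coefficients are then polynomials in \<open>y\<close> over the module of
  characters, one of which has a nontorsion coefficient and hence is torsion for only finitely many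
  \<open>y\<close>. The degree drops, and when only linear terms are nontorsion, a
  shift by a multiple of the torsion moduli of the others multiplies the function by a constant other than \<open>1\<close>.
\<close>

unbundle fps_syntax

section \<open>Characters of the additive group\<close>

definition unit_character :: "('b::ab_group_add \<Rightarrow> complex) \<Rightarrow> bool" where
  "unit_character \<eta> \<longleftrightarrow> (\<forall>x y. \<eta> (x + y) = \<eta> x * \<eta> y) \<and> (\<forall>x. cmod (\<eta> x) = 1)"

lemma unit_character_add: "unit_character \<eta> \<Longrightarrow> \<eta> (x + y) = \<eta> x * \<eta> y"
  by (simp add: unit_character_def)

lemma unit_character_norm: "unit_character \<eta> \<Longrightarrow> cmod (\<eta> x) = 1"
  by (simp add: unit_character_def)

lemma unit_character_cnj: "unit_character \<eta> \<Longrightarrow> \<eta> x * cnj (\<eta> x) = 1"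
  by (metis complex_norm_square mult_1 of_real_1 power2_eq_square unit_character_norm)

lemma unit_character_0: 
  assumes "unit_character \<eta>" shows "\<eta> 0 = 1"
proof -
  have "\<eta> 0 * \<eta> 0 = \<eta> 0 * 1" using unit_character_add[OF assms, of 0 0] by simp
  moreover have "\<eta> 0 \<noteq> 0" using unit_character_norm[OF assms, of 0] by auto
  ultimately show ?thesis by simp
qed

lemma unit_character_diff: 
  assumes "unit_character \<eta>" shows "\<eta> (x - y) = \<eta> x * cnj (\<eta> y)"
proof -
  have "\<eta> x = \<eta> (x - y) * \<eta> y"
    by (metis assms diff_add_cancel unit_character_add)
  then show ?thesis
    using unit_character_cnj[OF assms, of y] by (simp add: mult.assoc)
qed

lemma unit_character_sum:
  assumes "unit_character \<eta>" shows "\<eta> (\<Sum>i\<in>A. f i) = (\<Prod>i\<in>A. \<eta> (f i))"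
  by (induction A rule: infinite_finite_induct)
     (auto simp: assms unit_character_0 unit_character_add)

lemma unit_character_prod:
  assumes "\<And>i. i \<in> A \<Longrightarrow> unit_character (\<eta> i)" 
  shows "unit_character (\<lambda>x. \<Prod>i\<in>A. \<eta> i x)"
  unfolding unit_character_def
proof (intro conjI allI)
  show "(\<Prod>i\<in>A. \<eta> i (x + y)) = (\<Prod>i\<in>A. \<eta> i x) * (\<Prod>i\<in>A. \<eta> i y)" for x y
    unfolding prod.distrib[symmetric] by (intro prod.cong refl unit_character_add assms)
  show "cmod (\<Prod>i\<in>A. \<eta> i x) = 1" for x
    unfolding prod_norm[symmetric] by (intro prod.neutral ballI unit_character_norm assms)
qed

lemma unit_character_compose:
  assumes "unit_character \<eta>" "\<And>x y. g (x + y) = g x + g y"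
  shows "unit_character (\<lambda>x. \<eta> (g x))"
  using assms by (simp add: unit_character_def)

section \<open>Torsion in the module of characters\<close>

text \<open>The ring acts on its characters by sending \<open>\<eta>\<close> to
  \<open>x \<mapsto> \<eta> (N * x)\<close>; torsion is meant for this module structure.\<close>

definition torsion_character :: "('b::comm_ring_1 \<Rightarrow> complex) \<Rightarrow> bool" where
  "torsion_character \<eta> \<longleftrightarrow> (\<exists>N. N \<noteq> 0 \<and> (\<forall>x. \<eta> (N * x) = 1))"

text \<open>Read the product as the value at y of a polynomial of degree n with coefficients
  \<open>\<eta> i\<close> in the module of characters. Subtracting the value at one torsion point a
  and dividing by y - a lowers the degree and keeps the leading coefficient. By induction that
  coefficient is torsion; it is then stripped off and induction applies again.\<close>

lemma torsion_coefficients: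
  fixes \<eta> :: "nat \<Rightarrow> 'b::idom \<Rightarrow> complex"
  assumes "\<And>i. i \<le> n \<Longrightarrow> unit_character (\<eta> i)"
    and "infinite {y. torsion_character (\<lambda>x. \<Prod>i\<le>n. \<eta> i (y ^ i * x))}"
    and "i \<le> n"
  shows "torsion_character (\<eta> i)"
  using assms
proof (induction n arbitrary: \<eta> i)
  case 0
  then show ?case by (auto split: if_splits)
next
  case (Suc n)
  define Y where "Y = {y. torsion_character (\<lambda>x. \<Prod>i\<le>Suc n. \<eta> i (y ^ i * x))}"
  have inf: "infinite Y" using Suc.prems by (simp add: Y_def)
  then obtain a where "a \<in> Y" by (metis finite.emptyI ex_in_conv)
  then obtain A where A: "A \<noteq> 0" "\<And>x. (\<Prod>i\<le>Suc n. \<eta> i (a ^ i * (A * x))) = 1"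
    unfolding Y_def torsion_character_def by blast
  \<comment> \<open>Coefficients of the divided difference at a, where y^e contributes the powers
    a^(e - 1 - i) of (y^e - a^e)/(y - a).\<close>
  define \<theta> where "\<theta> i x = (\<Prod>e\<in>{i<..Suc n}. \<eta> e (a ^ (e - Suc i) * x))" for i x
  have uc: "unit_character (\<theta> i)" for i
    unfolding \<theta>_def
    by (intro unit_character_prod unit_character_compose[OF Suc.prems(1)])
      (auto simp: algebra_simps)
  have tor: "torsion_character (\<lambda>x. \<Prod>i\<le>n. \<theta> i (y ^ i * x))" if y: "y \<in> Y - {a}" for y
  proof -
    from y obtain B where B: "B \<noteq> 0" "\<And>x. (\<Prod>i\<le>Suc n. \<eta> i (y ^ i * (B * x))) = 1"
      unfolding Y_def torsion_character_def by blast
    \<comment> \<open>The factor y - a turns the divided difference back into the difference of the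
      values at y and a, which B and A annihilate.\<close>
    have "(\<Prod>i\<le>n. \<theta> i (y ^ i * ((y - a) * A * B * x))) = 1" for x
    proof -
      define z where "z = A * B * x"
      have "(\<Prod>i\<le>n. \<theta> i (y ^ i * ((y - a) * A * B * x)))
        = (\<Prod>i\<le>n. \<Prod>e\<in>{i<..Suc n}. \<eta> e (a ^ (e - Suc i) * (y ^ i * ((y - a) * z))))"
        unfolding \<theta>_def z_def by (simp only: mult.assoc)
      also have "\<dots> = (\<Prod>i\<in>{..n}. \<Prod>e\<in>{e\<in>{..Suc n}. i < e}. \<eta> e (a ^ (e - Suc i) * (y ^ i * ((y - a) * z))))"
        by (intro prod.cong refl) auto
      also have "\<dots> = (\<Prod>e\<in>{..Suc n}. \<Prod>i\<in>{i\<in>{..n}. i < e}. \<eta> e (a ^ (e - Suc i) * (y ^ i * ((y - a) * z))))"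
        by (intro prod.swap_restrict) auto
      also have "\<dots> = (\<Prod>e\<le>Suc n. \<Prod>i<e. \<eta> e (a ^ (e - Suc i) * (y ^ i * ((y - a) * z))))"
        by (intro prod.cong refl) auto
      also have "\<dots> = (\<Prod>e\<le>Suc n. \<eta> e ((y ^ e - a ^ e) * z))"
      proof (intro prod.cong refl)
        fix e assume "e \<in> {..Suc n}"
        then have "(\<Prod>i<e. \<eta> e (a ^ (e - Suc i) * (y ^ i * ((y - a) * z))))
          = \<eta> e (\<Sum>i<e. a ^ (e - Suc i) * (y ^ i * ((y - a) * z)))"
          using Suc.prems(1) by (simp add: unit_character_sum)
        also have "(\<Sum>i<e. a ^ (e - Suc i) * (y ^ i * ((y - a) * z))) = (y ^ e - a ^ e) * z"
          by (simp add: power_diff_sumr2 sum_distrib_left sum_distrib_right mult_ac)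
        finally show "(\<Prod>i<e. \<eta> e (a ^ (e - Suc i) * (y ^ i * ((y - a) * z)))) = \<eta> e ((y ^ e - a ^ e) * z)" .
      qed
      also have "\<dots> = (\<Prod>e\<le>Suc n. \<eta> e (y ^ e * z)) * cnj (\<Prod>e\<le>Suc n. \<eta> e (a ^ e * z))"
        using Suc.prems(1)
        by (simp add: left_diff_distrib unit_character_diff prod.distrib del: prod.atMost_Suc)
      also have "(\<Prod>e\<le>Suc n. \<eta> e (y ^ e * z)) = 1"
        using B(2)[of "A * x"] by (simp only: z_def mult_ac)
      also have "(\<Prod>e\<le>Suc n. \<eta> e (a ^ e * z)) = 1"
        using A(2)[of "B * x"] by (simp only: z_def mult_ac)
      finally show ?thesis by simp
    qed
    then show ?thesis unfolding torsion_character_def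
      using A(1) B(1) y by (intro exI[of _ "(y - a) * A * B"]) auto
  qed
  have "infinite (Y - {a})" using inf by simp
  then have "infinite {y. torsion_character (\<lambda>x. \<Prod>i\<le>n. \<theta> i (y ^ i * x))}"
    by (rule infinite_super[rotated]) (auto intro!: tor)
  then have "torsion_character (\<theta> n)"
    by (intro Suc.IH uc) simp_all
  then have top: "torsion_character (\<eta> (Suc n))"
  proof -
    have "\<theta> n x = \<eta> (Suc n) x" for x
      unfolding \<theta>_def atLeastSucAtMost_greaterThanAtMost[symmetric] by simp
    then show ?thesis using \<open>torsion_character (\<theta> n)\<close> by (simp add: torsion_character_def)
  qed
  then obtain T where T: "T \<noteq> 0" "\<And>x. \<eta> (Suc n) (T * x) = 1"
    unfolding torsion_character_def by blast
  \<comment> \<open>Multiplying B by the annihilator T of the leading coefficient removes the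
    leading term at each y.\<close>
  have "torsion_character (\<lambda>x. \<Prod>i\<le>n. \<eta> i (y ^ i * x))" if "y \<in> Y" for y
  proof -
    from that obtain B where B: "B \<noteq> 0" "\<And>x. (\<Prod>i\<le>Suc n. \<eta> i (y ^ i * (B * x))) = 1"
      unfolding Y_def torsion_character_def by blast
    have "(\<Prod>i\<le>n. \<eta> i (y ^ i * (B * T * x))) = 1" for x
    proof -
      have "y ^ Suc n * (B * (T * x)) = T * (y ^ Suc n * (B * x))" by (simp only: mult_ac)
      then show ?thesis
        using B(2)[of "T * x"] T(2)[of "y ^ Suc n * (B * x)"]
        by (simp only: prod.atMost_Suc mult_1_right mult.assoc)
    qed
    then show ?thesis unfolding torsion_character_def
      using T(1) B(1) by (intro exI[of _ "B * T"]) auto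
  qed
  then have "infinite {y. torsion_character (\<lambda>x. \<Prod>i\<le>n. \<eta> i (y ^ i * x))}"
    by (intro infinite_super[OF _ inf]) blast
  then have "i \<le> n \<Longrightarrow> torsion_character (\<eta> i)"
    by (intro Suc.IH Suc.prems(1)) simp_all
  then show ?case
    using Suc.prems(3) top by (auto simp: le_Suc_eq)
qed

section \<open>Characters of the finite base field\<close>

text \<open>If H is maximal among the additive subgroups avoiding 1, every element is h plus a
  multiple of 1 with h in H. The character is trivial on H and sends 1 to a p-th root of unity other
  than 1.\<close>

lemma exists_nontrivial_character:
  "\<exists>\<psi> :: 'a::{field,finite} \<Rightarrow> complex. unit_character \<psi> \<and> (\<exists>x. \<psi> x \<noteq> 1)"
proof -
  define p where "p = CHAR('a)"
  have p: "prime p" "p > 1"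
    unfolding p_def using prime_CHAR_semidom[where ?'a = 'a] finite_imp_CHAR_pos[where ?'a='a] prime_gt_1_nat by auto
  \<comment> \<open>Such an H automatically contains negatives, since -x is the multiple (p - 1)
    x.\<close>
  define G where "G = {H :: 'a set. 0 \<in> H \<and> (\<forall>x\<in>H. \<forall>y\<in>H. x + y \<in> H) \<and> 1 \<notin> H}"
  have "finite G" by simp
  moreover have "{0} \<in> G" by (simp add: G_def)
  ultimately obtain H where H: "H \<in> G" "\<And>H'. H' \<in> G \<Longrightarrow> H \<subseteq> H' \<Longrightarrow> H = H'"
    by (metis empty_iff finite_has_maximal)
  have H0: "0 \<in> H" and Hadd: "\<And>x y. x \<in> H \<Longrightarrow> y \<in> H \<Longrightarrow> x + y \<in> H" and H1: "1 \<notin> H"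
    using H(1) by (auto simp: G_def)
  have Hmul: "of_nat n * x \<in> H" if "x \<in> H" for n x
    by (induction n) (auto simp: H0 Hadd that algebra_simps)
  have neg: "of_nat (p - 1) * x = - x" for x :: 'a
  proof -
    have "of_nat (p - 1) + 1 = (of_nat p :: 'a)" using p(2)
      by (metis Suc_diff_1 Suc_lessD add.commute of_nat_Suc One_nat_def)
    then have "of_nat (p - 1) = (-1 :: 'a)" by (simp add: p_def eq_neg_iff_add_eq_0)
    then show ?thesis by simp
  qed
  have Hneg: "- x \<in> H" if "x \<in> H" for x using Hmul[OF that] neg by metis
  have inv: "\<exists>n. of_nat (n * m) = (1::'a)" if "\<not> p dvd m" for m
  proof -
    have "coprime m p" using p that by (metis coprime_commute prime_imp_coprime)
    then obtain n where "[m * n = 1] (mod p)" using cong_solve_coprime_nat[of m p] by auto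
    then have "of_nat (m * n) = (of_nat 1 :: 'a)"
      unfolding p_def by (simp only: of_nat_eq_iff_cong_CHAR)
    then show ?thesis by (auto simp: mult.commute)
  qed
  have ofnat_H: "p dvd m" if "of_nat m \<in> H" for m
    using inv[of m] Hmul[OF that] H1 by (metis of_nat_mult)
  have ex: "\<exists>h\<in>H. \<exists>c. x = h + of_nat c" for x
  proof (cases "x \<in> H")
    case True then show ?thesis by (intro bexI[of _ x] exI[of _ 0]) auto
  next
    case False
    \<comment> \<open>H together with the multiples of x exceeds H, so by maximality it contains 1 =
      h + n x. As 1 is not in H, p does not divide n, so the equation can be solved for x.\<close>
    define H' where "H' = {h + of_nat n * x |h n. h \<in> H}"
    have "H \<subseteq> H'" unfolding H'_def by (force intro: exI[of _ 0])
    have "x \<in> H'" unfolding H'_def by (smt (verit) H0 add_0 mem_Collect_eq mult_1 of_nat_1)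
    have "0 \<in> H'" using \<open>H \<subseteq> H'\<close> H0 by auto
    moreover have "a + b \<in> H'" if "a \<in> H'" "b \<in> H'" for a b
    proof -
      from that obtain h n h' n' where "h \<in> H" "h' \<in> H" "a = h + of_nat n * x" "b = h' + of_nat n' * x"
        unfolding H'_def by blast
      then have "a + b = (h + h') + of_nat (n + n') * x" "h + h' \<in> H" by (auto simp: algebra_simps Hadd)
      then show ?thesis unfolding H'_def by blast
    qed
    ultimately have "1 \<in> H'"
      using H(2)[of H'] \<open>H \<subseteq> H'\<close> \<open>x \<in> H'\<close> False unfolding G_def by blast
    then obtain h n where hn: "h \<in> H" "1 = h + of_nat n * x" unfolding H'_def by blast
    have "\<not> p dvd n"
      using hn H1 unfolding p_def by (metis add.right_neutral mult_zero_left of_nat_eq_0_iff_char_dvd)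
    then obtain n' where n': "of_nat (n' * n) = (1::'a)" using inv by blast
    have "x = of_nat (n' * n) * x" unfolding n' by simp
    also have "\<dots> = of_nat n' * (1 - h)" using hn(2) by (metis add_diff_cancel_left' of_nat_mult mult.assoc)
    also have "\<dots> = - (of_nat n' * h) + of_nat n'" by (simp add: algebra_simps)
    finally show ?thesis using Hneg[OF Hmul[OF hn(1), of n']] by metis
  qed
  define w where "w = cis (2 * pi / real p)"
  have wp: "w ^ p = 1" using p by (simp add: w_def DeMoivre)
  have w1: "w \<noteq> 1"
  proof
    assume "w = 1"
    then have "cos (2 * pi / p) = 1" by (simp add: w_def complex_eq_iff)
    then obtain n :: int where "2 * pi / p = n * 2 * pi" by (auto simp: cos_one_2pi_int)
    then have "1 = real_of_int n * p" using p by (simp add: field_simps)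
    then have "1 = n * int p" by (metis of_int_1 of_int_eq_iff of_int_mult of_int_of_nat_eq)
    then show False using p by (metis abs_of_nat abs_zmult_eq_1 mult.commute of_nat_1_eq_iff less_irrefl)
  qed
  have wcong: "w ^ m = w ^ n" if "[m = n] (mod p)" for m n
  proof -
    have "w ^ m = w ^ (m mod p)" for m
      by (subst mult_div_mod_eq[of p m, symmetric], simp only: power_add power_mult wp power_one mult_1)
    then show ?thesis using that unfolding cong_def by metis
  qed
  define \<psi> where "\<psi> x = w ^ (SOME c. \<exists>h\<in>H. x = h + of_nat c)" for x :: 'a
  \<comment> \<open>Well-definedness: two representations differ by an integer in H, which must be a
    multiple of p. The natural number c + (p - 1) c' stands in for c - c'.\<close>
  have \<psi>: "\<psi> (h + of_nat c) = w ^ c" if "h \<in> H" for h c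
  proof -
    define c' where "c' = (SOME c'. \<exists>h'\<in>H. h + of_nat c = h' + of_nat c')"
    have "\<exists>h'\<in>H. h + of_nat c = h' + (of_nat c' :: 'a)"
      unfolding c'_def by (rule someI[of _ c]) (use that in auto)
    then obtain h' where h': "h' \<in> H" "h + of_nat c = h' + (of_nat c' :: 'a)" by blast
    have eq: "of_nat (c + (p - 1) * c') = h' + - h"
    proof -
      have "of_nat (c + (p - 1) * c') = of_nat c - (of_nat c' :: 'a)"
        using neg[of "of_nat c'"] by (simp only: of_nat_add of_nat_mult) simp
      also have "\<dots> = h' + - h" using h'(2) by (simp add: algebra_simps)
      finally show ?thesis .
    qed
    have "p dvd c + (p - 1) * c'" 
      by (rule ofnat_H) (unfold eq, intro Hadd h' Hneg that)
    then have "[c + (p - 1) * c' + c' = 0 + c'] (mod p)"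
      by (intro cong_add) (auto simp: cong_0_iff)
    moreover have "c + (p - 1) * c' + c' = c + p * c'"
      using p by (cases p) (auto simp: algebra_simps)
    ultimately have "[c + p * c' = c'] (mod p)" by (simp only: add_0)
    then have "[c = c'] (mod p)" by (simp add: cong_def)
    then show ?thesis unfolding \<psi>_def c'_def[symmetric] using wcong by metis
  qed
  have "unit_character \<psi>"
    unfolding unit_character_def
  proof (intro conjI allI)
    fix x y
    obtain h c h' c' where "h \<in> H" "h' \<in> H" "x = h + of_nat c" "y = h' + of_nat c'" using ex by metis
    moreover from this have "x + y = (h + h') + of_nat (c + c')" "h + h' \<in> H" by (auto simp: Hadd)
    ultimately show "\<psi> (x + y) = \<psi> x * \<psi> y" using \<psi> power_add by metis
  next
    fix x
    show "cmod (\<psi> x) = 1" by (simp add: \<psi>_def w_def norm_power)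
  qed
  moreover have "\<psi> 1 \<noteq> 1" using \<psi>[OF H0, of 1] w1 by simp
  ultimately show ?thesis by blast
qed

text \<open>For nonzero y, translating b by z / y permutes the field and multiplies the sum by
  \<open>\<psi> z\<close>, which is not 1.\<close>

lemma additive_character_orthogonality:
  fixes \<psi> :: "'a::{field,finite} \<Rightarrow> complex"
  assumes \<psi>: "unit_character \<psi>" "\<psi> z \<noteq> 1"
  shows "(\<Sum>b\<in>UNIV. \<psi> (b * y)) = (if y = 0 then of_nat (card (UNIV :: 'a set)) else 0)"
proof (cases "y = 0")
  case True
  then show ?thesis using \<psi> by (simp add: unit_character_0)
next
  case False
  have "(\<Sum>b\<in>UNIV. \<psi> (b * y)) = (\<Sum>b\<in>UNIV. \<psi> ((b + z / y) * y))"
    by (rule sum.reindex_bij_witness[of _ "\<lambda>b. b + z / y" "\<lambda>b. b - z / y"]) auto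
  also have "\<dots> = (\<Sum>b\<in>UNIV. \<psi> (b * y)) * \<psi> z"
    using False by (simp add: distrib_right unit_character_add[OF \<psi>(1)] sum_distrib_right)
  finally show ?thesis using \<psi>(2) False by simp
qed

section \<open>Means along Folner sequences\<close>

definition fmean :: "'b set \<Rightarrow> ('b \<Rightarrow> complex) \<Rightarrow> complex" where
  "fmean A f = (\<Sum>u\<in>A. f u) / of_nat (card A)"

lemma fmean_scale: "fmean A (\<lambda>u. c * f u) = c * fmean A f"
  by (simp add: fmean_def sum_distrib_left)

lemma fmean_sum: "fmean A (\<lambda>u. \<Sum>i\<in>I. f i u) = (\<Sum>i\<in>I. fmean A (f i))"
proof -
  have "(\<Sum>u\<in>A. \<Sum>i\<in>I. f i u) = (\<Sum>i\<in>I. \<Sum>u\<in>A. f i u)" by (rule sum.swap)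
  then show ?thesis by (simp add: fmean_def sum_divide_distrib)
qed

lemma norm_fmean_le:
  assumes "\<And>u. u \<in> A \<Longrightarrow> cmod (f u) \<le> 1"
  shows "cmod (fmean A f) \<le> 1"
proof -
  have "cmod (\<Sum>u\<in>A. f u) \<le> real (card A)"
    using sum_norm_bound[of A f 1] assms by simp
  then show ?thesis
    by (cases "card A = 0") (simp_all add: fmean_def norm_divide divide_le_eq)
qed

text \<open>The squared modulus is kept as \<open>f u * cnj (f u)\<close> so that it can be expanded
  into correlations when f is an average of translates.\<close>

lemma fmean_Cauchy_Schwarz:
  "(cmod (fmean A f))\<^sup>2 \<le> cmod (fmean A (\<lambda>u. f u * cnj (f u)))"
proof (cases "card A = 0")
  case True
  then show ?thesis by (simp add: fmean_def)
next
  case False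
  have "(cmod (\<Sum>u\<in>A. f u))\<^sup>2 \<le> (\<Sum>u\<in>A. cmod (f u))\<^sup>2"
    by (intro power_mono norm_sum) simp
  also have "\<dots> \<le> real (card A) * (\<Sum>u\<in>A. (cmod (f u))\<^sup>2)"
    using sum_squared_le_sum_of_squares[where I = A and f = "\<lambda>u. cmod (f u)"] False
    by (simp add: mult.commute card_eq_0_iff)
  also have "(\<Sum>u\<in>A. (cmod (f u))\<^sup>2) = cmod (\<Sum>u\<in>A. f u * cnj (f u))"
  proof -
    have "(\<Sum>u\<in>A. f u * cnj (f u)) = of_real (\<Sum>u\<in>A. (cmod (f u))\<^sup>2)"
      by (simp only: of_real_sum complex_norm_square)
    then show ?thesis by (simp only: norm_of_real) (simp add: sum_nonneg)
  qed
  finally show ?thesis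
    using False by (simp add: fmean_def norm_divide power_divide field_simps power2_eq_square)
qed

text \<open>The two sums cancel on the overlap of \<open>F N\<close> with its translate; what
  remains is a vanishing proportion by the Folner condition.\<close>

lemma fmean_translate:
  fixes F :: "nat \<Rightarrow> (nat \<Rightarrow> 'a::comm_ring poly) set"
  assumes F: "folner d F" and v: "v \<in> Zd d" and f: "\<And>u. cmod (f u) \<le> 1"
  shows "(\<lambda>N. fmean (F N) (\<lambda>u. f (\<lambda>j. u j + v j)) - fmean (F N) f) \<longlonglongrightarrow> 0"
proof -
  define g where "g x = (\<lambda>j. x j + v j)" for x :: "nat \<Rightarrow> 'a poly"
  define \<rho> where "\<rho> N = real (card (F N \<inter> g ` F N)) / real (card (F N))" for N
  have \<rho>: "\<rho> \<longlonglongrightarrow> 1"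
    using F v unfolding folner_def \<rho>_def g_def by blast
  have inj: "inj g" unfolding g_def inj_def by (metis add_right_cancel ext)
  have bound: "cmod (fmean (F N) (\<lambda>u. f (g u)) - fmean (F N) f) \<le> 2 * (1 - \<rho> N)" for N
  proof -
    have fin: "finite (F N)" and ne: "F N \<noteq> {}" using F by (auto simp: folner_def)
    let ?A = "F N" and ?B = "g ` F N"
    have card: "card ?B = card ?A" using inj by (simp add: card_image inj_on_subset)
    have pos: "card ?A > 0" using fin ne by (simp add: card_gt_0_iff)
    have "(\<Sum>u\<in>?A. f (g u)) = (\<Sum>u\<in>?B. f u)"
      using inj by (simp add: sum.reindex inj_on_subset)
    also have "\<dots> = (\<Sum>u\<in>?B - ?A. f u) + (\<Sum>u\<in>?A \<inter> ?B. f u)"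
      using fin by (simp add: sum.Int_Diff[of ?B f ?A] Int_commute add.commute)
    also have "\<dots> - (\<Sum>u\<in>?A. f u) = (\<Sum>u\<in>?B - ?A. f u) - (\<Sum>u\<in>?A - ?B. f u)"
      using fin by (simp add: sum.Int_Diff[of ?A f ?B])
    finally have eq: "(\<Sum>u\<in>?A. f (g u)) - (\<Sum>u\<in>?A. f u) = \<dots>" by simp
    have "cmod \<dots> \<le> real (card (?B - ?A)) + real (card (?A - ?B))"
      using sum_norm_bound[of "?B - ?A" f 1] sum_norm_bound[of "?A - ?B" f 1] f
        norm_triangle_ineq4[of "\<Sum>u\<in>?B - ?A. f u" "\<Sum>u\<in>?A - ?B. f u"] by force
    also have "\<dots> = 2 * (real (card ?A) - real (card (?A \<inter> ?B)))"
    proof -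
      have "card ?B = card (?B \<inter> ?A) + card (?B - ?A)" "card ?A = card (?A \<inter> ?B) + card (?A - ?B)"
        using fin by (metis card_Int_Diff finite_imageI Int_commute)+
      then show ?thesis using card by (simp add: Int_commute)
    qed
    finally have le: "cmod ((\<Sum>u\<in>?A. f (g u)) - (\<Sum>u\<in>?A. f u)) \<le> 2 * (real (card ?A) - real (card (?A \<inter> ?B)))"
      unfolding eq .
    have "cmod (fmean (F N) (\<lambda>u. f (g u)) - fmean (F N) f)
      = cmod ((\<Sum>u\<in>?A. f (g u)) - (\<Sum>u\<in>?A. f u)) / card ?A"
      by (simp add: fmean_def norm_divide flip: diff_divide_distrib)
    also have "\<dots> \<le> 2 * (real (card ?A) - real (card (?A \<inter> ?B))) / card ?A"
      by (intro divide_right_mono le) simp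
    also have "\<dots> = 2 * (1 - \<rho> N)"
      using pos by (simp add: \<rho>_def field_simps)
    finally show ?thesis .
  qed
  have "(\<lambda>N. 2 * (1 - \<rho> N)) \<longlonglongrightarrow> 2 * (1 - 1)" by (intro tendsto_intros \<rho>)
  then have lim: "(\<lambda>N. 2 * (1 - \<rho> N)) \<longlonglongrightarrow> 0" by simp
  have "(\<lambda>N. cmod (fmean (F N) (\<lambda>u. f (g u)) - fmean (F N) f)) \<longlonglongrightarrow> 0"
    by (rule tendsto_sandwich[OF always_eventually always_eventually tendsto_const lim])
      (intro allI bound norm_ge_zero)+
  then show ?thesis
    unfolding g_def by (rule tendsto_norm_zero_cancel)
qed

text \<open>Average f over n shifts, apply Cauchy-Schwarz and expand into n^2 correlations. Each row
  has at most C bad ones, so these contribute at most C / n, while the others tend to 0.\<close>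

lemma van_der_Corput:
  fixes F :: "nat \<Rightarrow> (nat \<Rightarrow> 'a::comm_ring poly) set" and h :: "nat \<Rightarrow> nat \<Rightarrow> 'a poly"
  assumes F: "folner d F" and h: "\<And>i. h i \<in> Zd d" and f: "\<And>u. cmod (f u) \<le> 1"
    and C: "\<And>i n. card {j. j < n \<and> \<not> (\<lambda>N. fmean (F N)
              (\<lambda>u. f (\<lambda>m. u m + h i m) * cnj (f (\<lambda>m. u m + h j m)))) \<longlonglongrightarrow> 0} \<le> C"
  shows "(\<lambda>N. fmean (F N) f) \<longlonglongrightarrow> 0"
proof (rule metric_LIMSEQ_I)
  fix \<epsilon> :: real assume \<epsilon>: "\<epsilon> > 0"
  define c where "c i j N = fmean (F N) (\<lambda>u. f (\<lambda>m. u m + h i m) * cnj (f (\<lambda>m. u m + h j m)))" for i j N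
  \<comment> \<open>With this n the bad pairs contribute less than \<epsilon>^2.\<close>
  obtain n :: nat where n: "real C / \<epsilon>\<^sup>2 < n"
    using reals_Archimedean2 by blast
  moreover have "real C / \<epsilon>\<^sup>2 \<ge> 0" by simp
  ultimately have "n > 0" by linarith
  note n = n this
  then have Cn: "sqrt (C / n) < \<epsilon>"
    using \<epsilon> by (intro real_less_lsqrt) (auto simp: field_simps)
  define good where "good = {(i, j). i < n \<and> j < n \<and> c i j \<longlonglongrightarrow> 0}"
  define bad where "bad = (SIGMA i:{..<n}. {j. j < n \<and> \<not> c i j \<longlonglongrightarrow> 0})"
  define a where "a N = fmean (F N) f" for N
  define b where "b N = (\<Sum>i<n. fmean (F N) (\<lambda>u. f (\<lambda>m. u m + h i m))) / n" for N
  define r where "r N = (\<Sum>(i, j)\<in>good. cmod (c i j N)) / n\<^sup>2" for N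
  have c1: "cmod (c i j N) \<le> 1" for i j N
    unfolding c_def by (intro norm_fmean_le) (use f in \<open>auto simp: norm_mult intro!: mult_le_one\<close>)
  have ba: "(\<lambda>N. b N - a N) \<longlonglongrightarrow> 0"
  proof -
    have "b N - a N = (\<Sum>i<n. fmean (F N) (\<lambda>u. f (\<lambda>m. u m + h i m)) - fmean (F N) f) / n" for N
      using n by (simp add: b_def a_def sum_subtractf field_simps)
    moreover have "(\<lambda>N. (\<Sum>i<n. fmean (F N) (\<lambda>u. f (\<lambda>m. u m + h i m)) - fmean (F N) f) / n) \<longlonglongrightarrow> (\<Sum>i<n. 0) / of_nat n"
      by (intro tendsto_divide tendsto_sum tendsto_const fmean_translate[OF F] h f) (use n in simp)
    ultimately show ?thesis by (simp only: sum.neutral_const div_0)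
  qed
  have fingood: "finite good" 
    by (rule finite_subset[of _ "{..<n} \<times> {..<n}"]) (auto simp: good_def)
  have r: "r \<longlonglongrightarrow> 0"
  proof -
    have "(\<lambda>N. case x of (i, j) \<Rightarrow> cmod (c i j N)) \<longlonglongrightarrow> 0" if "x \<in> good" for x
      using that by (auto simp: good_def tendsto_norm_zero_iff)
    then have "(\<lambda>N. \<Sum>x\<in>good. case x of (i, j) \<Rightarrow> cmod (c i j N)) \<longlonglongrightarrow> (\<Sum>x\<in>good. 0)"
      by (intro tendsto_sum)
    then show ?thesis unfolding r_def by (intro tendsto_divide_zero) simp
  qed
  have b: "(cmod (b N))\<^sup>2 \<le> C / n + r N" for N
  proof -
    define g where "g u = (\<Sum>i<n. f (\<lambda>m. u m + h i m)) / n" for u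
    have "b N = fmean (F N) g"
      unfolding b_def g_def divide_complex_def
      by (subst (2) mult.commute, subst fmean_scale, subst fmean_sum) (simp add: mult.commute)
    then have "(cmod (b N))\<^sup>2 \<le> cmod (fmean (F N) (\<lambda>u. g u * cnj (g u)))"
      using fmean_Cauchy_Schwarz by metis
    also have "(\<lambda>u. g u * cnj (g u)) = (\<lambda>u. 1 / of_nat (n\<^sup>2) * (\<Sum>x\<in>{..<n}\<times>{..<n}.
        f (\<lambda>m. u m + h (fst x) m) * cnj (f (\<lambda>m. u m + h (snd x) m))))"
      by (simp add: g_def fun_eq_iff sum_product sum.cartesian_product power2_eq_square case_prod_unfold)
    also have "fmean (F N) \<dots> = 1 / of_nat (n\<^sup>2) * (\<Sum>x\<in>{..<n}\<times>{..<n}. c (fst x) (snd x) N)"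
      by (simp only: fmean_scale fmean_sum c_def)
    also have "cmod \<dots> \<le> (\<Sum>x\<in>{..<n}\<times>{..<n}. cmod (c (fst x) (snd x) N)) / n\<^sup>2"
      by (simp add: norm_mult norm_divide norm_power norm_sum divide_right_mono)
    also have "{..<n}\<times>{..<n} = bad \<union> good" by (auto simp: bad_def good_def)
    also have "(\<Sum>x\<in>bad \<union> good. cmod (c (fst x) (snd x) N)) 
      = (\<Sum>x\<in>bad. cmod (c (fst x) (snd x) N)) + (\<Sum>x\<in>good. cmod (c (fst x) (snd x) N))"
      by (rule sum.union_disjoint[OF _ fingood]) (auto simp: bad_def good_def)
    also have "(\<Sum>x\<in>bad. cmod (c (fst x) (snd x) N)) \<le> real (card bad) * 1"
      by (rule sum_bounded_above) (use c1 in auto)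
    also have "card bad \<le> n * C"
    proof -
      have "card bad = (\<Sum>i<n. card {j. j < n \<and> \<not> c i j \<longlonglongrightarrow> 0})"
        unfolding bad_def by (subst card_SigmaI) auto
      also have "\<dots> \<le> (\<Sum>i<n. C)"
        by (intro sum_mono C[folded c_def])
      finally show ?thesis by simp
    qed
    also have "(real (n * C) * 1 + (\<Sum>x\<in>good. cmod (c (fst x) (snd x) N))) / n\<^sup>2 = C / n + r N"
      using n by (simp add: r_def add_divide_distrib power2_eq_square case_prod_unfold)
    finally show ?thesis by (simp add: divide_right_mono)
  qed
  have "cmod (a N) \<le> cmod (b N - a N) + sqrt (C / n + r N)" for N
  proof -
    have "cmod (b N) \<le> sqrt (C / n + r N)" using b by (simp add: real_le_rsqrt)
    moreover have "cmod (a N) \<le> cmod (b N - a N) + cmod (b N)"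
      by (metis norm_minus_commute norm_triangle_sub add.commute)
    ultimately show ?thesis by simp
  qed
  moreover have "(\<lambda>N. cmod (b N - a N) + sqrt (C / n + r N)) \<longlonglongrightarrow> 0 + sqrt (C / n + 0)"
    by (intro tendsto_intros r tendsto_norm_zero ba)
  then have "eventually (\<lambda>N. cmod (b N - a N) + sqrt (C / n + r N) < \<epsilon>) sequentially"
    by (rule order_tendstoD(2)) (use Cn in simp)
  ultimately have "eventually (\<lambda>N. cmod (a N) < \<epsilon>) sequentially"
    by (elim eventually_mono) (meson le_less_trans)
  then show "\<exists>no. \<forall>n\<ge>no. dist (fmean (F n) f) 0 < \<epsilon>"
    by (simp add: a_def eventually_sequentially)
qed

section \<open>Polynomials with character coefficients\<close>

definition mon :: "nat \<Rightarrow> (nat \<Rightarrow> nat) \<Rightarrow> (nat \<Rightarrow> 'b::comm_semiring_1) \<Rightarrow> 'b" where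
  "mon d s u = (\<Prod>j<d. u j ^ s j)"

lemma mon_scale: "mon d (\<lambda>j. q * s j) u = mon d s u ^ q"
  by (simp add: mon_def prod_power_distrib power_mult[symmetric] mult.commute)

text \<open>The top binomial term cancels against the original monomial; each remaining term lowers
  only the j-th exponent, so the total degree drops.\<close>

lemma mon_translate:
  fixes u :: "nat \<Rightarrow> 'b::comm_ring_1"
  assumes "j < d"
  shows "mon d s (\<lambda>i. u i + (if i = j then h else 0)) - mon d s u
    = (\<Sum>i<s j. of_nat (s j choose i) * h ^ (s j - i) * mon d (s(j := i)) u)"
proof -
  define R where "R = (\<Prod>i\<in>{..<d} - {j}. u i ^ s i)"
  have upd: "mon d (s(j := i)) u = u j ^ i * R" for i
    unfolding mon_def R_def using assms
    by (subst prod.remove[of _ j]) (auto intro!: prod.cong)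
  have "mon d s (\<lambda>i. u i + (if i = j then h else 0)) = (u j + h) ^ s j * R"
    unfolding mon_def R_def using assms
    by (subst prod.remove[of _ j]) (auto intro!: prod.cong)
  also have "(u j + h) ^ s j = (\<Sum>i<s j. of_nat (s j choose i) * u j ^ i * h ^ (s j - i)) + u j ^ s j"
    by (simp add: binomial_ring flip: lessThan_Suc_atMost)
  finally show ?thesis
    using upd[of "s j"] by (simp add: upd algebra_simps sum_distrib_left)
qed

section \<open>Exponent vectors and the Frobenius map\<close>

text \<open>Divide by p while all entries are divisible; a fixed nonzero entry shrinks each time, so
  this ends at a core m. The zero vector is its own core.\<close>

lemma power_separable_decomposition:
  fixes s :: "nat \<Rightarrow> nat"
  assumes "p > 1"
  shows "\<exists>v m. s = (\<lambda>j. p ^ v * m j) \<and> (m = (\<lambda>_. 0) \<or> (\<exists>j. \<not> p dvd m j))"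
proof (cases "s = (\<lambda>_. 0)")
  case True
  then show ?thesis by (intro exI[of _ 0] exI[of _ "\<lambda>_. 0"]) auto
next
  case False
  then obtain i where "s i \<noteq> 0" by auto
  then show ?thesis
  proof (induction "s i" arbitrary: s rule: less_induct)
    case less
    show ?case
    proof (cases "\<exists>j. \<not> p dvd s j")
      case True
      then show ?thesis by (intro exI[of _ 0] exI[of _ s]) auto
    next
      case False
      define t where "t j = s j div p" for j
      have st: "s j = p * t j" for j using False by (simp add: t_def)
      have "t i < s i" "t i \<noteq> 0" using st[of i] less.prems assms by auto
      with less.hyps[of t] have "\<exists>v m. t = (\<lambda>j. p ^ v * m j) \<and> (m = (\<lambda>_. 0) \<or> (\<exists>j. \<not> p dvd m j))" .
      then obtain v m where "t = (\<lambda>j. p ^ v * m j)" "m = (\<lambda>_. 0) \<or> (\<exists>j. \<not> p dvd m j)"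
        by (elim exE conjE)
      then show ?thesis using st by (intro exI[of _ "Suc v"] exI[of _ m]) (auto simp: fun_eq_iff)
    qed
  qed
qed

lemma power_separable_choice:
  fixes p :: nat
  assumes "p > 1"
  shows "\<exists>(v :: (nat \<Rightarrow> nat) \<Rightarrow> nat) \<mu>. \<forall>s. s = (\<lambda>j. p ^ v s * \<mu> s j) \<and> (\<mu> s = (\<lambda>_. 0) \<or> (\<exists>j. \<not> p dvd \<mu> s j))"
proof -
  have "\<forall>s :: nat \<Rightarrow> nat. \<exists>v m. s = (\<lambda>j. p ^ v * m j) \<and> (m = (\<lambda>_. 0) \<or> (\<exists>j. \<not> p dvd m j))"
    by (intro allI power_separable_decomposition assms)
  from choice[OF this] obtain v
    where "\<forall>s :: nat \<Rightarrow> nat. \<exists>m. s = (\<lambda>j. p ^ v s * m j) \<and> (m = (\<lambda>_. 0) \<or> (\<exists>j. \<not> p dvd m j))" ..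
  from choice[OF this] show ?thesis by (rule exI[of _ v])
qed

text \<open>This makes \<open>x \<mapsto> \<eta> (x ^ p ^ v)\<close> a character again, which is
  what lets p-divisible exponents be reduced.\<close>

lemma frobenius_add:
  fixes x y :: "'a::{field,finite} poly"
  shows "(x + y) ^ (CHAR('a) ^ n) = x ^ (CHAR('a) ^ n) + y ^ (CHAR('a) ^ n)"
  by (rule freshmans_dream')
    (use prime_CHAR_semidom[where ?'a = 'a] finite_imp_CHAR_pos[where ?'a = 'a] in auto)

lemma frobenius_diff:
  fixes x y :: "'a::{field,finite} poly"
  shows "(x - y) ^ (CHAR('a) ^ n) = x ^ (CHAR('a) ^ n) - y ^ (CHAR('a) ^ n)"
  using frobenius_add[of "x - y" y n] by (simp add: algebra_simps)

text \<open>Chooses the differencing direction and the term to follow. A second nonzero coordinate j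
  can be lowered to 0, with binomial coefficient 1, while entry a survives. Otherwise l sits on a
  alone with \<open>l a\<close> at least 2, and is lowered to 1 with binomial coefficient
  \<open>l a\<close>.\<close>

lemma separable_step:
  fixes p :: nat and l :: "nat \<Rightarrow> nat"
  assumes p: "p > 1" and a: "\<not> p dvd l a" and l: "\<And>j. j \<ge> d \<Longrightarrow> l j = 0" and 2: "(\<Sum>j<d. l j) \<ge> 2"
  obtains j i b where "j < d" "i < l j" "\<not> p dvd (l j choose i)" "\<not> p dvd (l(j := i)) b"
proof (cases "\<exists>j. j \<noteq> a \<and> l j \<noteq> 0")
  case True
  then obtain j where j: "j \<noteq> a" "l j \<noteq> 0" by blast
  show ?thesis
    by (rule that[of j 0 a]) (use j a l[of j] p in \<open>auto intro: ccontr\<close>)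
next
  case False
  have "a < d" using l[of a] a by (metis dvd_0_right not_le_imp_less)
  have "(\<Sum>j<d. l j) = (\<Sum>j\<in>{a}. l j)"
    using False \<open>a < d\<close> by (intro sum.mono_neutral_right) auto
  then have "l a \<ge> 2" using 2 by simp
  then show ?thesis
    using \<open>a < d\<close> a p by (intro that[of a 1 a]) auto
qed

text \<open>Since V is at least v, the shift parameter is itself a p^v-th power; the outer power can
  be absorbed into a character and a monomial in y remains.\<close>

lemma frobenius_power_factor:
  fixes y :: "'b::comm_semiring_1" and p :: nat
  assumes "v \<le> V"
  shows "(y ^ p ^ V) ^ n * mon d (\<lambda>j. p ^ v * m j) u = (y ^ (p ^ (V - v) * n) * mon d m u) ^ p ^ v"
proof -
  have "p ^ V = p ^ (V - v) * p ^ v" using assms by (simp flip: power_add)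
  then show ?thesis
    unfolding mon_scale by (simp add: power_mult_distrib power_mult[symmetric] mult_ac)
qed


section \<open>The differencing induction\<close>

lemma character_polynomial_mean:
  fixes \<eta> :: "(nat \<Rightarrow> nat) \<Rightarrow> 'a::{field,finite} poly \<Rightarrow> complex"
  assumes "finite S"
    and "\<And>s. s \<in> S \<Longrightarrow> s = (\<lambda>_. 0) \<or> (\<exists>j. \<not> CHAR('a) dvd s j)"
    and "\<And>s j. s \<in> S \<Longrightarrow> j \<ge> d \<Longrightarrow> s j = 0"
    and "\<And>s. s \<in> S \<Longrightarrow> (\<Sum>j<d. s j) \<le> D"
    and "\<And>s. s \<in> S \<Longrightarrow> unit_character (\<eta> s)"
    and "l \<in> S" and "l \<noteq> (\<lambda>_. 0)" and "\<not> torsion_character (\<eta> l)"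
    and "folner d F"
  shows "(\<lambda>N. fmean (F N) (\<lambda>u. \<Prod>s\<in>S. \<eta> s (mon d s u))) \<longlonglongrightarrow> 0"
  using assms(1-8)
proof (induction D arbitrary: S \<eta> l)
  case 0
  have "l j = 0" for j
    using "0.prems"(3)[of l j] "0.prems"(4)[of l] "0.prems"(6) by (cases "j < d") auto
  then show ?case using "0.prems"(7) by auto
next
  case (Suc D)
  define p where "p = CHAR('a)"
  have p: "prime p" "p > 1"
    unfolding p_def using prime_CHAR_semidom[where ?'a = 'a] finite_imp_CHAR_pos[where ?'a = 'a]
      prime_gt_1_nat by auto
  note fin = Suc.prems(1) and sep = Suc.prems(2)[folded p_def] and supp = Suc.prems(3)
    and wt = Suc.prems(4) and uc = Suc.prems(5)
  define f where "f u = (\<Prod>s\<in>S. \<eta> s (mon d s u))" for u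
  have f1: "cmod (f u) = 1" for u
    unfolding f_def by (simp add: uc unit_character_norm flip: prod_norm)
  define dir where "dir j h = (\<lambda>i::nat. if i = j then h else 0)" for j and h :: "'a poly"
  have dir: "dir j h \<in> Zd d" if "j < d" for j h using that by (auto simp: dir_def Zd_def)
  have diff: "\<eta> s (mon d s (\<lambda>m. u m + dir j h m)) = \<eta> s (mon d s u) *
     \<eta> s (\<Sum>i<s j. of_nat (s j choose i) * h ^ (s j - i) * mon d (s(j := i)) u)"
    if "s \<in> S" "j < d" for s j h u
    unfolding unit_character_add[OF uc[OF that(1)], symmetric] mon_translate[OF that(2), symmetric]
    by (simp add: dir_def)
  show ?case
  proof (cases "\<exists>l\<in>S. l \<noteq> (\<lambda>_. 0) \<and> \<not> torsion_character (\<eta> l) \<and> (\<Sum>j<d. l j) \<ge> 2")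
    case True
    then obtain l where l: "l \<in> S" "l \<noteq> (\<lambda>_. 0)" "\<not> torsion_character (\<eta> l)" "(\<Sum>j<d. l j) \<ge> 2"
      by blast
    from sep[OF l(1)] l(2) obtain a where a: "\<not> p dvd l a" by auto
    obtain j k b where j: "j < d" and k: "k < l j" "\<not> p dvd (l j choose k)"
      and b: "\<not> p dvd (l(j := k)) b"
      by (rule separable_step[OF p(2) a supp[OF l(1)] l(4)])
    \<comment> \<open>A pair (s, i) is the term of the difference in direction j that comes from s
      with its j-th exponent lowered to i.\<close>
    define I where "I = (SIGMA s:S. {..<s j})"
    have finI: "finite I" using fin by (simp add: I_def)
    obtain v' :: "(nat \<Rightarrow> nat) \<Rightarrow> nat" and \<mu>'
      where *: "\<forall>s. s = (\<lambda>i. p ^ v' s * \<mu>' s i) \<and> (\<mu>' s = (\<lambda>_. 0) \<or> (\<exists>i. \<not> p dvd \<mu>' s i))"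
      using power_separable_choice[OF p(2)] by (elim exE)
    define v \<mu> where "v x = v' ((fst x)(j := snd x))" and "\<mu> x = \<mu>' ((fst x)(j := snd x))" for x
    have core: "(fst x)(j := snd x) = (\<lambda>i. p ^ v x * \<mu> x i)" for x
      unfolding v_def \<mu>_def by (rule conjunct1[OF spec[OF *]])
    have \<mu>: "\<mu> x = (\<lambda>_. 0) \<or> (\<exists>i. \<not> p dvd \<mu> x i)" for x
      unfolding \<mu>_def by (rule conjunct2[OF spec[OF *]])
    \<comment> \<open>Any common bound of the \<open>v x\<close> would do; their sum is one.\<close>
    define V where "V = sum v I"
    have vV: "v x \<le> V" if "x \<in> I" for x
      unfolding V_def using that finI by (intro member_le_sum) auto
    \<comment> \<open>The exponent of y once the p^(v x)-th power is taken out of (y^(p^V))^(s j -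
      i).\<close>
    define E where "E x = p ^ (V - v x) * (fst x j - snd x)" for x
    define \<theta> where "\<theta> x z = \<eta> (fst x) (of_nat (fst x j choose snd x) * z ^ p ^ v x)" for x z
    \<comment> \<open>The coefficient of the core monomial m in the reduced difference, a polynomial
      in y over the module of characters.\<close>
    define \<xi> where "\<xi> y m z = (\<Prod>x\<in>{x\<in>I. \<mu> x = m}. \<theta> x (y ^ E x * z))" for y m z
    have uc\<theta>: "unit_character (\<theta> x)" if "x \<in> I" for x
      unfolding \<theta>_def
      by (rule unit_character_compose[OF uc])
        (use that in \<open>auto simp: I_def p_def frobenius_add algebra_simps\<close>)
    have uc\<xi>: "unit_character (\<xi> y m)" for y m
      unfolding \<xi>_def
      by (intro unit_character_prod unit_character_compose[OF uc\<theta>]) (auto simp: algebra_simps)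
    have deriv: "f (\<lambda>m. u m + dir j (y ^ p ^ V) m) * cnj (f u) = (\<Prod>m\<in>\<mu> ` I. \<xi> y m (mon d m u))" for y u
    proof -
      have "f (\<lambda>m. u m + dir j (y ^ p ^ V) m) = f u * (\<Prod>s\<in>S. \<eta> s (\<Sum>i<s j.
          of_nat (s j choose i) * (y ^ p ^ V) ^ (s j - i) * mon d (s(j := i)) u))"
        unfolding f_def prod.distrib[symmetric] by (intro prod.cong refl diff j)
      also have "\<dots> = f u * (\<Prod>s\<in>S. \<Prod>i<s j. \<eta> s (
          of_nat (s j choose i) * (y ^ p ^ V) ^ (s j - i) * mon d (s(j := i)) u))"
        by (intro arg_cong2[where f = "(*)"] prod.cong refl unit_character_sum uc)
      also have "\<dots> = f u * (\<Prod>x\<in>I. \<eta> (fst x) (of_nat (fst x j choose snd x) *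
          ((y ^ p ^ V) ^ (fst x j - snd x) * mon d ((fst x)(j := snd x)) u)))"
        unfolding I_def using fin by (subst prod.Sigma) (auto simp: case_prod_unfold mult.assoc)
      also have "\<dots> = f u * (\<Prod>x\<in>I. \<theta> x (y ^ E x * mon d (\<mu> x) u))"
        unfolding core \<theta>_def E_def
        by (intro arg_cong2[where f = "(*)"] prod.cong refl, subst frobenius_power_factor) (auto intro: vV)
      also have "(\<Prod>x\<in>I. \<theta> x (y ^ E x * mon d (\<mu> x) u)) = (\<Prod>m\<in>\<mu> ` I. \<xi> y m (mon d m u))"
        unfolding \<xi>_def by (subst prod.image_gen[OF finI, of _ \<mu>]) (auto intro!: prod.cong)
      finally show ?thesis
        using f1[of u] by (simp add: mult.assoc mult.commute[of "f u"] complex_norm_square[symmetric])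
    qed
    define m where "m = l(j := k)"
    have lkI: "(l, k) \<in> I" using l k by (simp add: I_def)
    have lk: "v (l, k) = 0" "\<mu> (l, k) = m"
    proof -
      have eq: "m = (\<lambda>i. p ^ v (l, k) * \<mu> (l, k) i)" using core[of "(l, k)"] by (simp add: m_def)
      then show "v (l, k) = 0" using b unfolding m_def[symmetric]
        by (metis dvd_mult2 dvd_power gr_zeroI)
      then show "\<mu> (l, k) = m" using eq by simp
    qed
    \<comment> \<open>Equal cores and equal y-exponents force s = p^(v x) l in every entry, the j-th
      included because E determines s j - i. As s is nonzero and not divisible by p,
      \<open>v x\<close> is 0 and the pair is (l, k).\<close>
    have uniq: "x = (l, k)" if "x \<in> I" "\<mu> x = m" "E x = p ^ V * (l j - k)" for x
    proof -
      obtain s i where x: "x = (s, i)" by (cases x)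
      have si: "s \<in> S" "i < s j" using that(1) by (auto simp: I_def x)
      have c: "s(j := i) = (\<lambda>a. p ^ v x * m a)" using core[of x] that(2) by (simp add: x)
      have i: "i = p ^ v x * k" using fun_cong[OF c, of j] by (simp add: m_def)
      have "p ^ (V - v x) * (s j - i) = p ^ (V - v x) * (p ^ v x * (l j - k))"
        using that(3) vV[OF that(1)] by (simp add: E_def x mult.assoc[symmetric] flip: power_add)
      then have "s j - i = p ^ v x * (l j - k)" using p by simp
      then have "s j = p ^ v x * l j" using si(2) i k(1) by (simp add: diff_mult_distrib2)
      moreover have "s a = p ^ v x * l a" if "a \<noteq> j" for a
        using fun_cong[OF c, of a] that by (simp add: m_def)
      ultimately have s: "s a = p ^ v x * l a" for a by (cases "a = j") auto
      have "s \<noteq> (\<lambda>_. 0)" using si(2) by auto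
      then have "v x = 0" using sep[OF si(1)] s by (metis dvd_mult2 dvd_power gr_zeroI)
      then have "s a = l a" "i = k" for a using s[of a] i by simp_all
      then show ?thesis unfolding x by blast
    qed
    define bad where "bad = {y. torsion_character (\<xi> y m)}"
    have finbad: "finite bad"
    proof (rule ccontr)
      assume inf: "infinite bad"
      define n where "n = sum E I"
      have En: "E x \<le> n" if "x \<in> I" for x
        unfolding n_def using that finI by (intro member_le_sum) auto
      \<comment> \<open>The coefficient of y^e in \<open>\<xi> y m\<close>; for e = p^V (l j - k) it
        consists of the single term (l, k).\<close>
      define \<zeta> where "\<zeta> e z = (\<Prod>x\<in>{x\<in>{x\<in>I. \<mu> x = m}. E x = e}. \<theta> x z)" for e z
      have "\<xi> y m z = (\<Prod>e\<le>n. \<zeta> e (y ^ e * z))" for y z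
      proof -
        have "\<xi> y m z = (\<Prod>e\<le>n. \<Prod>x\<in>{x\<in>{x\<in>I. \<mu> x = m}. E x = e}. \<theta> x (y ^ E x * z))"
          unfolding \<xi>_def by (rule prod.group[symmetric]) (use finI En in auto)
        then show ?thesis by (simp add: \<zeta>_def)
      qed
      then have "\<xi> y m = (\<lambda>z. \<Prod>e\<le>n. \<zeta> e (y ^ e * z))" for y by auto
      then have inf': "infinite {y. torsion_character (\<lambda>z. \<Prod>e\<le>n. \<zeta> e (y ^ e * z))}"
        using inf by (simp add: bad_def)
      have "unit_character (\<zeta> e)" for e
        unfolding \<zeta>_def by (intro unit_character_prod uc\<theta>) auto
      moreover have Elk: "E (l, k) = p ^ V * (l j - k)" by (simp add: E_def lk)
      ultimately have "torsion_character (\<zeta> (p ^ V * (l j - k)))"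
        using torsion_coefficients[OF _ inf'] En[OF lkI] by simp
      moreover have single: "{x\<in>{x\<in>I. \<mu> x = m}. E x = p ^ V * (l j - k)} = {(l, k)}"
      proof (intro equalityI subsetI)
        fix x assume "x \<in> {x\<in>{x\<in>I. \<mu> x = m}. E x = p ^ V * (l j - k)}"
        then show "x \<in> {(l, k)}" using uniq[of x] by blast
      next
        fix x assume "x \<in> {(l, k)}"
        then show "x \<in> {x\<in>{x\<in>I. \<mu> x = m}. E x = p ^ V * (l j - k)}" by (simp add: lkI lk Elk)
      qed
      have "\<zeta> (p ^ V * (l j - k)) = \<theta> (l, k)"
        unfolding \<zeta>_def single by (simp add: fun_eq_iff)
      ultimately have "torsion_character (\<theta> (l, k))" by simp
      then obtain N where N: "N \<noteq> 0" "\<And>z. \<eta> l (of_nat (l j choose k) * (N * z)) = 1"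
        by (auto simp: torsion_character_def \<theta>_def lk)
      \<comment> \<open>The binomial coefficient is a nonzero constant, so it can be merged into the
        annihilator N.\<close>
      have "of_nat (l j choose k) \<noteq> (0 :: 'a poly)"
        using k(2) by (simp add: of_nat_eq_0_iff_char_dvd p_def)
      then have "torsion_character (\<eta> l)"
        unfolding torsion_character_def
        using N by (intro exI[of _ "of_nat (l j choose k) * N"]) (simp add: mult.assoc)
      then show False using l by simp
    qed
    have good: "(\<lambda>N. fmean (F N) (\<lambda>u. f (\<lambda>m. u m + dir j (y ^ p ^ V) m) * cnj (f u))) \<longlonglongrightarrow> 0"
      if "y \<notin> bad" for y
      unfolding deriv
    proof (rule Suc.IH)
      fix t assume "t \<in> \<mu> ` I"
      then obtain s i where x: "(s, i) \<in> I" "t = \<mu> (s, i)" by auto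
      then have si: "s \<in> S" "i < s j" by (auto simp: I_def)
      have c: "(s(j := i)) a = p ^ v (s, i) * t a" for a using core[of "(s, i)"] x by simp
      have p0: "p ^ a > 0" for a using p by simp
      show "t = (\<lambda>_. 0) \<or> (\<exists>j. \<not> CHAR('a) dvd t j)" using \<mu> x by (simp add: p_def)
      show "t a = 0" if "a \<ge> d" for a
        using c[of a] supp[OF si(1) that] that j p by (auto split: if_splits)
      \<comment> \<open>Passing to the core raises no exponent, and lowering the j-th one has
        strictly decreased the total degree.\<close>
      have "t a \<le> (s(j := i)) a" for a
        unfolding c using p0[of "v (s, i)"] by (metis Suc_leI mult.commute mult.right_neutral mult_le_mono2 One_nat_def)
      then have "(\<Sum>a<d. t a) \<le> (\<Sum>a<d. (s(j := i)) a)" by (intro sum_mono)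
      also have "\<dots> < (\<Sum>a<d. s a)"
        using si(2) j by (intro sum_strict_mono_ex1) auto
      finally show "(\<Sum>a<d. t a) \<le> D" using wt[OF si(1)] by simp
      show "unit_character (\<xi> y t)" by (rule uc\<xi>)
    next
      show "finite (\<mu> ` I)" using finI by simp
      show "m \<in> \<mu> ` I" using lk lkI by force
      show "m \<noteq> (\<lambda>_. 0)" using b[folded m_def] by auto
      show "\<not> torsion_character (\<xi> y m)" using that by (simp add: bad_def)
    qed
    \<comment> \<open>Powers of t supply infinitely many distinct shift parameters.\<close>
    define y where "y i = (monom 1 i :: 'a poly)" for i
    have yinj: "y i = y i' \<longleftrightarrow> i = i'" for i i' by (simp add: y_def monom_eq_iff')
    define h where "h i = dir j (y i ^ p ^ V)" for i
    have "(\<lambda>N. fmean (F N) f) \<longlonglongrightarrow> 0"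
    proof (rule van_der_Corput[OF assms(9)])
      show "h i \<in> Zd d" for i unfolding h_def by (intro dir j)
      show "cmod (f u) \<le> 1" for u by (simp add: f1)
      have *: "(\<lambda>N. fmean (F N) (\<lambda>u. f (\<lambda>m. u m + h i m) * cnj (f (\<lambda>m. u m + h i' m)))) \<longlonglongrightarrow> 0"
        if "y i - y i' \<notin> bad" for i i'
      proof -
        \<comment> \<open>By additivity of Frobenius, h i - h i' is the shift with parameter y i - y
          i', so the correlation is the translate by h i' of one difference.\<close>
        define g where "g u = f (\<lambda>m. u m + dir j ((y i - y i') ^ p ^ V) m) * cnj (f u)" for u
        have "(\<lambda>N. fmean (F N) (\<lambda>u. g (\<lambda>m. u m + h i' m)) - fmean (F N) g) \<longlonglongrightarrow> 0"
          by (rule fmean_translate[OF assms(9)]) (simp_all add: h_def dir j g_def norm_mult f1)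
        from tendsto_add[OF this good[OF that, folded g_def]]
        have "(\<lambda>N. fmean (F N) (\<lambda>u. g (\<lambda>m. u m + h i' m))) \<longlonglongrightarrow> 0" by simp
        moreover have "h i' m + dir j ((y i - y i') ^ p ^ V) m = h i m" for m
          by (simp add: h_def dir_def p_def frobenius_diff)
        ultimately show ?thesis by (simp add: g_def add.assoc)
      qed
      show "card {i'. i' < n \<and> \<not> (\<lambda>N. fmean (F N)
              (\<lambda>u. f (\<lambda>m. u m + h i m) * cnj (f (\<lambda>m. u m + h i' m)))) \<longlonglongrightarrow> 0} \<le> card bad" for i n
      proof (rule card_inj_on_le[where f = "\<lambda>i'. y i - y i'"])
        show "inj_on (\<lambda>i'. y i - y i') A" for A by (auto simp: inj_on_def yinj)
        show "finite bad" by (rule finbad)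
      qed (use * in blast)
    qed
    then show ?thesis by (simp add: f_def[abs_def])
  next
    case False
    have wtl: "(\<Sum>j<d. l j) < 2" using False Suc.prems(6-8) by auto
    obtain j where lj: "l j \<noteq> 0" using Suc.prems(7) by auto
    then have j: "j < d" using supp[OF Suc.prems(6), of j] by (meson not_le)
    \<comment> \<open>In the remaining case l has total degree 1, hence is the unit vector in
      direction j.\<close>
    have unit: "s i = (if i = j then 1 else 0)" 
      if "s \<in> S" "s j \<noteq> 0" "(\<Sum>a<d. s a) < 2" for s i
    proof -
      have "(\<Sum>a<d. s a) = s j + (\<Sum>a\<in>{..<d} - {j}. s a)" using j by (simp add: sum.remove)
      then have "s j = 1" "(\<Sum>a\<in>{..<d} - {j}. s a) = 0" using that by linarith+
      then show ?thesis using supp[OF that(1), of i] by (cases "i < d") auto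
    qed
    define T where "T = {s\<in>S. torsion_character (\<eta> s)}"
    have "\<forall>s\<in>T. \<exists>N. N \<noteq> 0 \<and> (\<forall>x. \<eta> s (N * x) = 1)" by (simp add: T_def torsion_character_def)
    then obtain n where n: "\<And>s. s \<in> T \<Longrightarrow> n s \<noteq> 0" "\<And>s x. s \<in> T \<Longrightarrow> \<eta> s (n s * x) = 1" by metis
    \<comment> \<open>N annihilates all torsion characters at once; as \<open>\<eta> l\<close> is
      not torsion, some multiple of N is sent away from 1.\<close>
    define N where "N = (\<Prod>s\<in>T. n s)"
    have finT: "finite T" using fin by (simp add: T_def)
    then have "N \<noteq> 0" using n by (simp add: N_def)
    then obtain x where x: "\<eta> l (N * x) \<noteq> 1" 
      using Suc.prems(8) unfolding torsion_character_def by blast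
    define h where "h = N * x"
    define c where "c = \<eta> l h"
    \<comment> \<open>For l the increment is h itself. For torsion s it is a multiple of h, hence of
      \<open>n s\<close>. Any other s does not involve u j, since a nontorsion exponent with s j > 0
      must equal l.\<close>
    have step: "\<eta> s (mon d s (\<lambda>m. u m + dir j h m)) = \<eta> s (mon d s u) * (if s = l then c else 1)"
      if s: "s \<in> S" for s u
    proof (cases "s = l")
      case True
      have "l(j := 0) = (\<lambda>_. 0)" using unit[OF Suc.prems(6) lj wtl] by auto
      then show ?thesis
        using unit[OF Suc.prems(6) lj wtl, of j] diff[OF Suc.prems(6) j, of u h]
        by (simp add: True c_def) (simp add: mon_def)
    next
      case False
      have "\<eta> s (\<Sum>i<s j. of_nat (s j choose i) * h ^ (s j - i) * mon d (s(j := i)) u) = 1"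
      proof (cases "s \<in> T")
        case True
        have "n s dvd N" unfolding N_def using finT True by (rule dvd_prodI)
        then have "n s dvd h" by (simp add: h_def)
        then have "n s dvd (\<Sum>i<s j. of_nat (s j choose i) * h ^ (s j - i) * mon d (s(j := i)) u)"
          by (intro dvd_sum dvd_mult2 dvd_mult) (auto intro: dvd_trans[OF _ dvd_power])
        then show ?thesis using n(2)[OF True] by (auto elim: dvdE)
      next
        case nT: False
        have "s j = 0"
        proof (rule ccontr)
          assume sj: "s j \<noteq> 0"
          then have "s \<noteq> (\<lambda>_. 0)" by auto
          then have "(\<Sum>a<d. s a) < 2" 
            using nT s \<open>\<not> (\<exists>l\<in>S. l \<noteq> (\<lambda>_. 0) \<and> \<not> torsion_character (\<eta> l) \<and> (\<Sum>j<d. l j) \<ge> 2)\<close>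
            unfolding T_def by (metis (mono_tags, lifting) mem_Collect_eq not_le)
          then have "s = l" 
            using unit[OF s sj] unit[OF Suc.prems(6) lj wtl] by auto
          then show False using False by simp
        qed
        then show ?thesis using uc[OF s] by (simp add: unit_character_0)
      qed
      then show ?thesis using diff[OF s j] False by simp
    qed
    have "f (\<lambda>m. u m + dir j h m) = c * f u" for u
      unfolding f_def using fin Suc.prems(6) by (simp add: step prod.distrib prod.delta)
    \<comment> \<open>The shift multiplies the mean by c but changes it by o(1), so (c - 1) times
      the mean tends to 0.\<close>
    then have "(\<lambda>N. c * fmean (F N) f - fmean (F N) f) \<longlonglongrightarrow> 0"
      using fmean_translate[OF assms(9) dir[OF j], of f h] f1 by (simp add: fmean_scale)
    then have "(\<lambda>N. (c * fmean (F N) f - fmean (F N) f) / (c - 1)) \<longlonglongrightarrow> 0 / (c - 1)"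
      using x by (intro tendsto_divide tendsto_const) (auto simp: c_def h_def)
    moreover have "(c * z - z) / (c - 1) = z" for z
      using x by (simp add: c_def h_def field_simps)
    ultimately show ?thesis by (simp add: f_def[abs_def])
  qed
qed

text \<open>Group the exponents by their cores and absorb the p-powers into the characters. No
  proper p-power multiple of l occurs in S, so l is alone in its group and keeps its nontorsion
  character.\<close>

lemma character_polynomial_mean_unreduced:
  fixes \<eta> :: "(nat \<Rightarrow> nat) \<Rightarrow> 'a::{field,finite} poly \<Rightarrow> complex"
  assumes fin: "finite S"
    and supp: "\<And>s j. s \<in> S \<Longrightarrow> j \<ge> d \<Longrightarrow> s j = 0"
    and uc: "\<And>s. s \<in> S \<Longrightarrow> unit_character (\<eta> s)"
    and l: "l \<in> S" "\<not> CHAR('a) dvd l i" "\<not> torsion_character (\<eta> l)"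
    and multiples: "\<And>v. v > 0 \<Longrightarrow> (\<lambda>j. CHAR('a) ^ v * l j) \<notin> S"
    and F: "folner d F"
  shows "(\<lambda>N. fmean (F N) (\<lambda>u. \<Prod>s\<in>S. \<eta> s (mon d s u))) \<longlonglongrightarrow> 0"
proof -
  define p where "p = CHAR('a)"
  have p: "p > 1"
    unfolding p_def using prime_CHAR_semidom[where ?'a = 'a] finite_imp_CHAR_pos[where ?'a = 'a]
      prime_gt_1_nat by auto
  obtain v :: "(nat \<Rightarrow> nat) \<Rightarrow> nat" and \<mu>
    where *: "\<forall>s. s = (\<lambda>i. p ^ v s * \<mu> s i) \<and> (\<mu> s = (\<lambda>_. 0) \<or> (\<exists>i. \<not> p dvd \<mu> s i))"
    using power_separable_choice[OF p] by (elim exE)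
  note core = conjunct1[OF spec[OF *]] and \<mu> = conjunct2[OF spec[OF *]]
  define \<theta> where "\<theta> m x = (\<Prod>s\<in>{s\<in>S. \<mu> s = m}. \<eta> s (x ^ p ^ v s))" for m x
  have "v l = 0" using l(2) fun_cong[OF core[of l], of i] unfolding p_def[symmetric]
    by (metis dvd_mult2 dvd_power gr_zeroI)
  then have \<mu>l: "\<mu> l = l" using core[of l] by simp
  have uniq: "s = l" if "s \<in> S" "\<mu> s = l" for s
  proof -
    have s: "s = (\<lambda>j. p ^ v s * l j)" using core[of s] that(2) by simp
    then have "v s = 0" using multiples[of "v s"] that(1) unfolding p_def[symmetric] by auto
    then show ?thesis using s by simp
  qed
  then have "{s\<in>S. \<mu> s = l} = {l}" using \<mu>l l(1) by auto
  then have \<theta>l: "\<theta> l = \<eta> l" using \<open>v l = 0\<close> by (simp add: \<theta>_def fun_eq_iff)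
  have eq: "(\<Prod>s\<in>S. \<eta> s (mon d s u)) = (\<Prod>m\<in>\<mu> ` S. \<theta> m (mon d m u))" for u
  proof -
    have "(\<Prod>s\<in>S. \<eta> s (mon d s u)) = (\<Prod>s\<in>S. \<eta> s (mon d (\<mu> s) u ^ p ^ v s))"
      by (intro prod.cong refl arg_cong[of _ _ "\<eta> _"]
          trans[OF arg_cong[OF core, of "\<lambda>t. mon d t u"] mon_scale])
    then show ?thesis
      unfolding \<theta>_def by (subst (asm) prod.image_gen[OF fin, of _ \<mu>]) (auto intro!: prod.cong)
  qed
  show ?thesis
    unfolding eq
  proof (rule character_polynomial_mean[OF _ _ _ _ _ _ _ _ F])
    fix m assume "m \<in> \<mu> ` S"
    then obtain s where s: "s \<in> S" "m = \<mu> s" by blast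
    have c: "s j = p ^ v s * m j" for j using fun_cong[OF core[of s], of j] s by simp
    show "m = (\<lambda>_. 0) \<or> (\<exists>j. \<not> CHAR('a) dvd m j)" using \<mu> s by (simp add: p_def)
    show "m j = 0" if "j \<ge> d" for j using c[of j] supp[OF s(1) that] p by simp
    \<comment> \<open>This fixes the degree bound D crudely, as the sum of the total degrees of all
      cores.\<close>
    show "(\<Sum>j<d. m j) \<le> (\<Sum>m\<in>\<mu> ` S. \<Sum>j<d. m j)"
      by (rule member_le_sum) (use fin s in auto)
    show "unit_character (\<theta> m)"
      unfolding \<theta>_def
      by (intro unit_character_prod unit_character_compose[OF uc])
        (auto simp: p_def frobenius_add)
  next
    show "finite (\<mu> ` S)" using fin by simp
    show "l \<in> \<mu> ` S" using \<mu>l l(1) by force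
    show "l \<noteq> (\<lambda>_. 0)" using l(2) by auto
    show "\<not> torsion_character (\<theta> l)" using \<theta>l l(3) by simp
  qed
qed

section \<open>Laurent series\<close>

lemma Z_to_R_nth: "Z_to_R u $$ n = (if n \<le> 0 then coeff u (nat (- n)) else 0)"
proof (cases "n \<le> 0")
  case True
  have "Z_to_R u $$ n = (\<Sum>i\<le>degree u. if i = nat (- n) then coeff u i else 0)"
    unfolding Z_to_R_def fls_nth_sum using True by (intro sum.cong) auto
  then show ?thesis using True by (auto simp: coeff_eq_0)
next
  case False
  then show ?thesis unfolding Z_to_R_def fls_nth_sum by (auto intro!: sum.neutral)
qed

lemma Z_to_R_add: "Z_to_R (x + y) = Z_to_R x + Z_to_R y"
  by (simp add: fls_eq_iff Z_to_R_nth)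

lemma Z_to_R_monom: "Z_to_R (monom a n) = fls_const a * fls_X_inv ^ n"
  by (auto simp: fls_eq_iff Z_to_R_nth)

lemma Z_to_R_0: "Z_to_R 0 = 0"
  by (simp add: fls_eq_iff Z_to_R_nth)

lemma Z_to_R_1: "Z_to_R 1 = 1"
  using Z_to_R_monom[of 1 0] by simp

lemma Z_to_R_sum: "Z_to_R (\<Sum>i\<in>A. f i) = (\<Sum>i\<in>A. Z_to_R (f i))"
  by (induction A rule: infinite_finite_induct) (auto simp: Z_to_R_0 Z_to_R_add)

text \<open>Checked on monomials and extended by bilinearity.\<close>

lemma Z_to_R_mult: "Z_to_R (x * y) = Z_to_R x * Z_to_R y"
proof -
  have monom: "Z_to_R (monom a m * monom b n) = Z_to_R (monom a m) * Z_to_R (monom b n)" for a b :: 'a and m n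
    by (simp add: mult_monom Z_to_R_monom power_add mult_ac flip: fls_const_mult_const)
  define f where "f z i = monom (coeff z i) i" for z :: "'a poly" and i
  have f: "(\<Sum>i\<le>degree z. f z i) = z" for z
    by (simp add: f_def poly_as_sum_of_monoms)
  have "Z_to_R ((\<Sum>i\<le>degree x. f x i) * (\<Sum>j\<le>degree y. f y j))
    = Z_to_R (\<Sum>i\<le>degree x. f x i) * Z_to_R (\<Sum>j\<le>degree y. f y j)"
    by (simp only: sum_product Z_to_R_sum f_def monom)
  then show ?thesis by (simp only: f)
qed

lemma Z_to_R_power: "Z_to_R (x ^ n) = Z_to_R x ^ n"
  by (induction n) (auto simp: Z_to_R_1 Z_to_R_mult)

lemma Z_to_R_mon: "Z_to_R (mon d s u) = (\<Prod>j<d. Z_to_R (u j) ^ s j)"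
  unfolding mon_def by (induction d) (auto simp: Z_to_R_1 Z_to_R_mult Z_to_R_power)

text \<open>A Laurent series has finitely many negative exponents; if no positive ones occur it is a
  polynomial in t, of degree at most k.\<close>

lemma Z_to_R_surj:
  assumes "\<And>n. n > 0 \<Longrightarrow> x $$ n = 0"
  obtains u where "x = Z_to_R u"
proof
  define k where "k = nat (- fls_subdegree x)"
  have *: "coeff (\<Sum>i\<le>k. monom (x $$ (- int i)) i) n = (if n \<le> k then x $$ (- int n) else 0)" for n
    by (simp add: coeff_sum)
  show "x = Z_to_R (\<Sum>i\<le>k. monom (x $$ (- int i)) i)"
    unfolding fls_eq_iff Z_to_R_nth * using assms by (auto simp: k_def)
qed

section \<open>Detecting digits by characters\<close>

text \<open>Orthogonality tests each digit separately; multiplying the M tests out gives a sum over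
  frequency vectors b.\<close>

lemma cylinder_indicator:
  fixes \<psi> :: "'a::{field,finite} \<Rightarrow> complex"
  assumes \<psi>: "unit_character \<psi>" "\<psi> z \<noteq> 1"
  shows "of_bool (in_cylinder M c x) = (1 / of_nat (card (UNIV :: 'a set)) ^ M) *
    (\<Sum>b\<in>PiE {1..M} (\<lambda>_. UNIV). \<psi> (\<Sum>i\<in>{1..M}. b i * (x $$ int i - c i)))"
proof -
  have "(\<Sum>b\<in>PiE {1..M} (\<lambda>_. UNIV). \<psi> (\<Sum>i\<in>{1..M}. b i * (x $$ int i - c i)))
    = (\<Prod>i\<in>{1..M}. \<Sum>b\<in>UNIV. \<psi> (b * (x $$ int i - c i)))"
    by (simp add: unit_character_sum[OF \<psi>(1)] prod_sum_PiE)
  also have "\<dots> = (\<Prod>i\<in>{1..M}. if x $$ int i = c i then of_nat (card (UNIV :: 'a set)) else 0)"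
    by (simp add: additive_character_orthogonality[OF \<psi>])
  also have "\<dots> = of_bool (in_cylinder M c x) * of_nat (card (UNIV :: 'a set)) ^ M"
    by (auto simp: in_cylinder_def prod_zero_iff)
  finally show ?thesis by simp
qed

text \<open>An annihilator N imposes a linear recurrence with coefficients b on the digits of
  \<alpha> N. Then \<alpha> N m is a polynomial for the nonzero m built from b, so \<alpha> would be
  rational.\<close>

lemma irrational_nontorsion:
  fixes \<psi> :: "'a::{field,finite} \<Rightarrow> complex"
  assumes \<psi>: "unit_character \<psi>" "\<psi> z \<noteq> 1" and \<alpha>: "\<not> in_Q \<alpha>"
    and b: "i0 \<in> {1..M}" "b i0 \<noteq> 0"
  shows "\<not> torsion_character (\<lambda>x. \<psi> (\<Sum>i\<in>{1..M}. b i * (\<alpha> * Z_to_R x) $$ int i))"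
proof
  assume "torsion_character (\<lambda>x. \<psi> (\<Sum>i\<in>{1..M}. b i * (\<alpha> * Z_to_R x) $$ int i))"
  then obtain N where N: "N \<noteq> 0" "\<And>x. \<psi> (\<Sum>i\<in>{1..M}. b i * (\<alpha> * Z_to_R (N * x)) $$ int i) = 1"
    unfolding torsion_character_def by blast
  define \<gamma> where "\<gamma> = \<alpha> * Z_to_R N"
  \<comment> \<open>Digits start at index 1, so with the shift i - 1 the coefficient k > 0 of
    \<gamma> m is the recurrence for n = k - 1.\<close>
  define m where "m = (\<Sum>i\<in>{1..M}. monom (b i) (i - 1))"
  have zero: "(\<Sum>i\<in>{1..M}. b i * \<gamma> $$ (int i + int n)) = 0" (is "?y = 0") for n
  proof (rule ccontr)
    assume "?y \<noteq> 0"
    \<comment> \<open>Testing x = a t^n for all a yields a \<open>\<psi>\<close>-value at every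
      multiple of \<open>?y\<close>, hence at z if \<open>?y\<close> is nonzero.\<close>
    have "\<alpha> * Z_to_R (N * monom a n) = fls_const a * (fls_X_inv ^ n * \<gamma>)" for a
      by (simp add: Z_to_R_mult Z_to_R_monom \<gamma>_def mult_ac)
    then have "(\<alpha> * Z_to_R (N * monom a n)) $$ k = a * \<gamma> $$ (k + int n)" for a k
      by (simp add: fls_X_inv_power_times_conv_shift)
    then have "\<psi> (a * ?y) = 1" for a
      using N(2)[of "monom a n"] by (simp add: sum_distrib_left mult_ac)
    from this[of "z / ?y"] show False using \<psi>(2) \<open>?y \<noteq> 0\<close> by simp
  qed
  have "(\<gamma> * Z_to_R m) $$ k = 0" if "k > 0" for k
  proof -
    have "\<gamma> * Z_to_R m = (\<Sum>i\<in>{1..M}. fls_const (b i) * (fls_X_inv ^ (i - 1) * \<gamma>))"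
      by (simp add: m_def Z_to_R_sum Z_to_R_monom sum_distrib_left mult_ac)
    then have "(\<gamma> * Z_to_R m) $$ k = (\<Sum>i\<in>{1..M}. b i * \<gamma> $$ (k + int (i - 1)))"
      by (simp add: fls_nth_sum fls_X_inv_power_times_conv_shift)
    also have "\<dots> = (\<Sum>i\<in>{1..M}. b i * \<gamma> $$ (int i + int (nat (k - 1))))"
      using that by (intro sum.cong refl arg_cong2[where f = "(*)"] arg_cong[where f = "fls_nth \<gamma>"]) auto
    also have "\<dots> = 0" by (rule zero)
    finally show ?thesis .
  qed
  then obtain w where "\<gamma> * Z_to_R m = Z_to_R w" by (rule Z_to_R_surj)
  then have "\<alpha> * Z_to_R (N * m) = Z_to_R w" by (simp add: \<gamma>_def Z_to_R_mult mult.assoc)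
  moreover have "coeff m (i0 - 1) = b i0"
  proof -
    have "coeff m (i0 - 1) = (\<Sum>i\<in>{1..M}. if i = i0 then b i else 0)"
      unfolding m_def coeff_sum using b(1) by (intro sum.cong) auto
    then show ?thesis using b(1) by simp
  qed
  then have "N * m \<noteq> 0" using N(1) b(2) by auto
  ultimately show False using \<alpha> unfolding in_Q_def by blast
qed

lemma finite_Sd: "finite (Sd d r)"
proof -
  have "Sd d r \<subseteq> {s. \<forall>j. (j \<in> {..<d} \<longrightarrow> s j \<in> {..r}) \<and> (j \<notin> {..<d} \<longrightarrow> s j = 0)}"
    by (auto simp: Sd_def intro!: member_le_sum)
  then show ?thesis by (rule finite_subset) (intro finite_set_of_finite_funs; simp)
qed

theorem theorem3p1:
  fixes d :: nat and K :: "nat set" and \<alpha>0 :: "'a::{field,finite} fls"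
    and \<alpha> :: "(nat \<Rightarrow> nat) \<Rightarrow> 'a fls" and k :: nat and l :: "nat \<Rightarrow> nat"
  assumes "finite K" and "0 \<notin> K"
    and "k \<in> K" and "l \<in> Sd d k"
    and "\<not> CHAR('a) dvd k"
    and "\<forall>v::nat. v > 0 \<longrightarrow> CHAR('a) ^ v * k \<notin> K"
    and "\<not> in_Q (\<alpha> l)"
  shows "well_distributed d (polyP d K \<alpha>0 \<alpha>)"
  unfolding well_distributed_def
proof (intro allI impI)
  fix F :: "nat \<Rightarrow> (nat \<Rightarrow> 'a poly) set" and M and c :: "nat \<Rightarrow> 'a"
  assume F: "folner d F"
  define P where "P = polyP d K \<alpha>0 \<alpha>"
  define Q :: complex where "Q = of_nat (card (UNIV :: 'a set)) ^ M"
  obtain \<psi> :: "'a \<Rightarrow> complex" and z where \<psi>: "unit_character \<psi>" "\<psi> z \<noteq> 1"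
    using exists_nontrivial_character by blast
  define S where "S = (\<Union>r\<in>K \<union> {0}. Sd d r)"
  have finS: "finite S" unfolding S_def using assms(1) finite_Sd by auto
  have lS: "l \<in> S" using assms(3,4) by (auto simp: S_def)
  have P: "P u = \<alpha>0 + (\<Sum>s\<in>S. \<alpha> s * Z_to_R (mon d s u))" for u
    unfolding P_def polyP_def S_def Z_to_R_mon using assms(1)
    by (subst sum.UNION_disjoint) (auto simp: finite_Sd, auto simp: Sd_def)
  have l_sum: "(\<Sum>j<d. l j) = k" using assms(4) by (simp add: Sd_def)
  obtain i where i: "\<not> CHAR('a) dvd l i"
    using assms(5) unfolding l_sum[symmetric] by (meson dvd_sum)
  \<comment> \<open>The total degree of the multiple is p^v k, which is positive and not in
    K.\<close>
  have multiples: "(\<lambda>j. CHAR('a) ^ v * l j) \<notin> S" if "v > 0" for v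
  proof
    assume "(\<lambda>j. CHAR('a) ^ v * l j) \<in> S"
    then have "(\<Sum>j<d. CHAR('a) ^ v * l j) \<in> K \<union> {0}"
      unfolding S_def Sd_def by blast
    then have "CHAR('a) ^ v * k \<in> K \<union> {0}"
      by (simp only: l_sum flip: sum_distrib_left)
    moreover have "CHAR('a) ^ v * k \<noteq> 0"
      using assms(2,3) finite_imp_CHAR_pos[where ?'a = 'a] by (auto intro: gr0I)
    ultimately show False using assms(6) that by auto
  qed
  define B where "B = PiE {1..M} (\<lambda>_. UNIV :: 'a set)"
  define e where "e b u = \<psi> (\<Sum>i\<in>{1..M}. b i * (P u $$ int i - c i))" for b u
  \<comment> \<open>The zero frequency, whose mean is constantly 1 and gives the main term; all
    others will average to 0.\<close>
  define b0 where "b0 = restrict (\<lambda>_. 0 :: 'a) {1..M}"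
  have finB: "finite B" by (simp add: B_def finite_PiE)
  have b0: "b0 \<in> B" by (simp add: B_def b0_def)
  have lim: "(\<lambda>N. fmean (F N) (e b)) \<longlonglongrightarrow> (if b = b0 then 1 else 0)" if "b \<in> B" for b
  proof (cases "b = b0")
    case True
    have "fmean (F N) (e b) = 1" for N
      using F \<psi> True by (simp add: folner_def fmean_def e_def b0_def unit_character_0)
    then show ?thesis using True by simp
  next
    case False
    have "\<exists>i0\<in>{1..M}. b i0 \<noteq> 0"
    proof (rule ccontr)
      assume "\<not> ?thesis"
      then have "b i = b0 i" for i using that
        by (cases "i \<in> {1..M}") (auto simp: b0_def B_def PiE_def extensional_def)
      then show False using False by auto
    qed
    then obtain i0 where i0: "i0 \<in> {1..M}" "b i0 \<noteq> 0" by blast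
    define \<eta> where "\<eta> s x = \<psi> (\<Sum>i\<in>{1..M}. b i * (\<alpha> s * Z_to_R x) $$ int i)" for s x
    \<comment> \<open>The constant term and the prescribed digits contribute only this factor,
      independent of u.\<close>
    define C where "C = \<psi> (\<Sum>i\<in>{1..M}. b i * (\<alpha>0 $$ int i - c i))"
    have "e b u = C * (\<Prod>s\<in>S. \<eta> s (mon d s u))" for u
    proof -
      have "(\<Sum>i\<in>{1..M}. b i * (P u $$ int i - c i)) = (\<Sum>i\<in>{1..M}. b i * (\<alpha>0 $$ int i - c i))
        + (\<Sum>i\<in>{1..M}. \<Sum>s\<in>S. b i * (\<alpha> s * Z_to_R (mon d s u)) $$ int i)"
        by (simp add: P fls_nth_sum algebra_simps sum_distrib_left flip: sum.distrib)
      also have "(\<Sum>i\<in>{1..M}. \<Sum>s\<in>S. b i * (\<alpha> s * Z_to_R (mon d s u)) $$ int i)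
        = (\<Sum>s\<in>S. \<Sum>i\<in>{1..M}. b i * (\<alpha> s * Z_to_R (mon d s u)) $$ int i)"
        by (rule sum.swap)
      finally show ?thesis
        by (simp only: e_def C_def \<eta>_def unit_character_add[OF \<psi>(1)] unit_character_sum[OF \<psi>(1), where A = S])
    qed
    then have e: "e b = (\<lambda>u. C * (\<Prod>s\<in>S. \<eta> s (mon d s u)))" by auto
    have "(\<lambda>N. fmean (F N) (\<lambda>u. \<Prod>s\<in>S. \<eta> s (mon d s u))) \<longlonglongrightarrow> 0"
    proof (rule character_polynomial_mean_unreduced[OF finS _ _ lS i _ multiples F])
      show "s j = 0" if "s \<in> S" "j \<ge> d" for s j using that by (auto simp: S_def Sd_def)
      show "unit_character (\<eta> s)" for s
        unfolding \<eta>_def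
        by (rule unit_character_compose[OF \<psi>(1)])
          (simp add: Z_to_R_add algebra_simps sum.distrib)
      show "\<not> torsion_character (\<eta> l)"
        unfolding \<eta>_def by (rule irrational_nontorsion[where M = M and b = b, OF \<psi> assms(7) i0])
    qed
    then show ?thesis using False by (simp add: e fmean_scale tendsto_mult_right_zero)
  qed
  have "complex_of_real (real (card {u \<in> F N. in_cylinder M c (P u)}) / real (card (F N)))
    = 1 / Q * (\<Sum>b\<in>B. fmean (F N) (e b))" for N
  proof -
    have "finite (F N)" using F by (simp add: folner_def)
    then have "complex_of_real (real (card {u \<in> F N. in_cylinder M c (P u)}) / real (card (F N)))
      = fmean (F N) (\<lambda>u. of_bool (in_cylinder M c (P u)))"
      by (simp add: fmean_def of_bool_def flip: sum.inter_filter)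
    also have "\<dots> = fmean (F N) (\<lambda>u. 1 / Q * (\<Sum>b\<in>B. e b u))"
      unfolding cylinder_indicator[OF \<psi>] e_def B_def Q_def ..
    finally show ?thesis by (simp only: fmean_scale fmean_sum)
  qed
  moreover have "(\<lambda>N. 1 / Q * (\<Sum>b\<in>B. fmean (F N) (e b))) \<longlonglongrightarrow> 1 / Q * (\<Sum>b\<in>B. if b = b0 then 1 else 0)"
    by (intro tendsto_mult tendsto_const tendsto_sum lim)
  moreover have "1 / Q * (\<Sum>b\<in>B. if b = b0 then 1 else 0) = complex_of_real (1 / real (card (UNIV :: 'a set)) ^ M)"
    using finB b0 by (simp add: Q_def)
  ultimately have "(\<lambda>N. complex_of_real (real (card {u \<in> F N. in_cylinder M c (P u)}) / real (card (F N))))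
      \<longlonglongrightarrow> complex_of_real (1 / real (card (UNIV :: 'a set)) ^ M)"
    by (simp only:)
  then show "(\<lambda>N. real (card {u \<in> F N. in_cylinder M c (polyP d K \<alpha>0 \<alpha> u)}) / real (card (F N)))
       \<longlonglongrightarrow> 1 / real (card (UNIV :: 'a set)) ^ M"
    unfolding P_def by (rule tendsto_of_real_iff[THEN iffD1])
qed

end
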